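(* For every $n\ge1$ there exists a family of bijections $\Phi_k:\mathfrak{S}_n\to\mathfrak{C}_n$, indexed by the integers $k\ge1$, such that for all $k\ge1$ and every $\sigma\in\mathfrak{S}_n$: (i) $\widetilde{\mathrm{maj}_k}(\sigma)=\sum(\Phi_k(\sigma))$; (ii) $\mathrm{des}_k(\sigma)=\mathrm{st}_k(\Phi_k(\sigma))$; (iii) $\widetilde{\mathrm{des}_{k+1}}(\sigma)=\mathrm{st}_k(\Phi_{k+1}(\sigma))$.
   Context: $\mathfrak{S}_n$ is the set of permutations of $\{1,\dots,n\}$. For $k\ge1$ and $\sigma\in\mathfrak{S}_n$: $\mathrm{DES}_k(\sigma)=\{i\in\{1,\dots,n-1\}:\sigma(i)\ge\sigma(i+1)+k\}$; $\mathrm{des}_k(\sigma)=|\mathrm{DES}_k(\sigma)|$; $\mathrm{maj}_k(\sigma)=\sum_{i\in\mathrm{DES}_k(\sigma)}i$; $\widetilde{\mathrm{des}_k}(\sigma)=\mathrm{des}_k(\sigma)$ if $\sigma(1)>n+1-k$, and $\widetilde{\mathrm{des}_k}(\sigma)=\mathrm{des}_k(\sigma)+1$ otherwise; $\widetilde{\mathrm{maj}_k}(\sigma)=\mathrm{maj}_k(\sigma)+\#\{(i,j):i<j\text{ and }\sigma(i)<\sigma(j)<\sigma(i)+k\}$. A code of length $n$ is a sequence of integers $c=(c(1),\dots,c(n))$ with $0\le c(i)<i$ for all $i$; $\mathfrak{C}_n$ is the set of codes of length $n$. For $c\in\mathfrak{C}_n$, $\sum(c)=c(1)+\cdots+c(n)$.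 The statistic $\mathrm{st}_k$ on codes is defined inductively: $\mathrm{st}_k$ of the unique code $(0)$ of length $1$ is $0$; for $n\ge2$ and $c\in\mathfrak{C}_n$ with prefix $c_{n-1}=(c(1),\dots,c(n-1))\in\mathfrak{C}_{n-1}$, $\mathrm{st}_k(c)=\mathrm{st}_k(c_{n-1})$ if $c(n)\le\mathrm{st}_k(c_{n-1})+k-1$, and $\mathrm{st}_k(c)=\mathrm{st}_k(c_{n-1})+1$ if $c(n)>\mathrm{st}_k(c_{n-1})+k-1$. *)

theory Defs
  imports Main "HOL-Library.FuncSet" "HOL-Combinatorics.Permutations"
begin

text \<open>
  A permutation in \<open>\<SS>\<^sub>n\<close> is a function \<open>\<sigma> :: nat \<Rightarrow> nat\<close> with \<open>\<sigma> permutes {1..n}\<close>, so it is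
  the identity outside \<open>{1..n}\<close>; since \<open>n\<close> cannot be recovered from \<open>\<sigma>\<close>, the statistics
  take it as a parameter. All positions are counted from 1.
\<close>

definition perms :: "nat \<Rightarrow> (nat \<Rightarrow> nat) set" where
  "perms n = {\<sigma>. \<sigma> permutes {1..n}}"

definition DES :: "nat \<Rightarrow> nat \<Rightarrow> (nat \<Rightarrow> nat) \<Rightarrow> nat set" where
  "DES k n \<sigma> = {i \<in> {1..n - 1}. \<sigma> i \<ge> \<sigma> (i + 1) + k}"

definition des :: "nat \<Rightarrow> nat \<Rightarrow> (nat \<Rightarrow> nat) \<Rightarrow> nat" where
  "des k n \<sigma> = card (DES k n \<sigma>)"

definition maj :: "nat \<Rightarrow> nat \<Rightarrow> (nat \<Rightarrow> nat) \<Rightarrow> nat" where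
  "maj k n \<sigma> = (\<Sum>i\<in>DES k n \<sigma>. i)"

text \<open>
  The condition \<open>\<sigma>(1) > n + 1 - k\<close> is an inequality of integers; it is written
  additively because subtraction on \<^typ>\<open>nat\<close> truncates.
\<close>

definition des_tilde :: "nat \<Rightarrow> nat \<Rightarrow> (nat \<Rightarrow> nat) \<Rightarrow> nat" where
  "des_tilde k n \<sigma> = (if \<sigma> 1 + k > n + 1 then des k n \<sigma> else des k n \<sigma> + 1)"

definition maj_tilde :: "nat \<Rightarrow> nat \<Rightarrow> (nat \<Rightarrow> nat) \<Rightarrow> nat" where
  "maj_tilde k n \<sigma> = maj k n \<sigma> +
     card {(i, j) \<in> {1..n} \<times> {1..n}. i < j \<and> \<sigma> i < \<sigma> j \<and> \<sigma> j < \<sigma> i + k}"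

text \<open>
  A code of length \<open>n\<close> is an extensional function on \<open>{1..n}\<close> (it is \<open>undefined\<close> elsewhere),
  so that codes of length \<open>n\<close> correspond exactly to sequences \<open>(c(1), \<dots>, c(n))\<close>.
\<close>

definition codes :: "nat \<Rightarrow> (nat \<Rightarrow> nat) set" where
  "codes n = (\<Pi>\<^sub>E i\<in>{1..n}. {0..<i})"

definition code_sum :: "nat \<Rightarrow> (nat \<Rightarrow> nat) \<Rightarrow> nat" where
  "code_sum n c = (\<Sum>i = 1..n. c i)"

text \<open>
  \<open>st k m c\<close> is the statistic of the prefix \<open>(c(1), \<dots>, c(m))\<close> of \<open>c\<close>; the value at
  \<open>m = 0\<close> is a convention that is never used for codes of positive length. For \<open>k \<ge> 1\<close>
  the subtraction below does not truncate.
\<close>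

fun st :: "nat \<Rightarrow> nat \<Rightarrow> (nat \<Rightarrow> nat) \<Rightarrow> nat" where
  "st k 0 c = 0"
| "st k (Suc 0) c = 0"
| "st k (Suc (Suc m)) c =
     (if c (Suc (Suc m)) \<le> st k (Suc m) c + k - 1
      then st k (Suc m) c else st k (Suc m) c + 1)"

end

theory Submission
  imports Defs
begin

text \<open>
  Decompose a permutation of \<open>{1..n + 1}\<close> as a permutation \<open>\<sigma>\<close> of \<open>{1..n}\<close> into which the
  \<^emph>\<open>smallest\<close> letter is inserted right after position \<open>p \<in> {0..n}\<close> (inserting the largest letter
  would not make the increments of \<open>maj_tilde\<close> distinct). Let \<open>S\<close> consist of \<open>0\<close>, the positions of
  the letters below \<open>k\<close>, and the \<open>k\<close>-descents of \<open>\<sigma>\<close>. The insertion creates a new \<open>k\<close>-descent iff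
  \<open>p \<notin> S\<close>, and it increases \<open>maj_tilde\<close> by the number of elements of \<open>S\<close> beyond \<open>p\<close>, plus \<open>p\<close> if
  \<open>p \<notin> S\<close>. This increment runs bijectively through \<open>{0..n}\<close> and is below \<open>card S\<close> iff \<open>p \<in> S\<close>;
  taking it as the last entry of the code gives the bijection. The tilde version of \<open>des\<close> counts
  the descents of \<open>\<sigma>\<close> preceded by \<open>\<sigma>(0) = n + 1\<close>. Its growth differs from that of \<open>des\<close> only for
  the insertion at \<open>p = 0\<close> when \<open>\<sigma>(0)\<close> is not yet a descent; there the increment is \<open>card S - 1\<close>,
  just above the threshold of \<open>st\<close> with parameter \<open>k - 1\<close>.
\<close>

section \<open>Inserting the smallest letter\<close>

text \<open>The value 0 at position 0 keeps that position fixed. Beyond the inserted letter the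
  shift of positions cancels the raise by one on fixed points, so the identity outside the domain
  persists.\<close>

definition ins_min :: "nat \<Rightarrow> (nat \<Rightarrow> nat) \<Rightarrow> nat \<Rightarrow> nat" where
  "ins_min p \<sigma> i = (if i = 0 then 0 else if i \<le> p then Suc (\<sigma> i)
     else if i = Suc p then 1 else Suc (\<sigma> (i - 1)))"

lemma perms_zero: "\<sigma> \<in> perms n \<Longrightarrow> \<sigma> 0 = 0"
  by (auto simp: perms_def permutes_def)

lemma perms_pos: "\<sigma> \<in> perms n \<Longrightarrow> 0 < i \<Longrightarrow> 0 < \<sigma> i"
  unfolding perms_def using perms_zero[of \<sigma> n] permutes_inj[of \<sigma> "{1..n}"]
  by (metis bot_nat_0.not_eq_extremum injD mem_Collect_eq perms_def)

lemma perms_le: "\<sigma> \<in> perms n \<Longrightarrow> i \<le> n \<Longrightarrow> \<sigma> i \<le> n"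
  using permutes_in_image[of \<sigma> "{1..n}" i] perms_zero[of \<sigma> n]
  by (cases "i = 0") (auto simp: perms_def)

lemma perms_eq_iff: "\<sigma> \<in> perms n \<Longrightarrow> \<sigma> i = \<sigma> j \<longleftrightarrow> i = j"
  unfolding perms_def using permutes_inj[of \<sigma> "{1..n}"] by (auto dest: injD)

lemma perms_eq_0_iff: "\<sigma> \<in> perms n \<Longrightarrow> \<sigma> i = 0 \<longleftrightarrow> i = 0"
  using perms_eq_iff[of \<sigma> n i 0] perms_zero[of \<sigma> n] by simp

lemma ins_min_perms:
  assumes \<sigma>: "\<sigma> \<in> perms n" and p: "p \<le> n"
  shows "ins_min p \<sigma> \<in> perms (Suc n)"
proof -
  have "inj_on (ins_min p \<sigma>) {1..Suc n}"
  proof (rule inj_onI)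
    fix i j assume ij: "i \<in> {1..Suc n}" "j \<in> {1..Suc n}" "ins_min p \<sigma> i = ins_min p \<sigma> j"
    then obtain i' j' where "i = Suc i'" "j = Suc j'"
      by (cases i; cases j) auto
    with ij show "i = j"
      by (auto simp: ins_min_def perms_eq_iff[OF \<sigma>] perms_eq_0_iff[OF \<sigma>] split: if_splits)
  qed
  moreover have "ins_min p \<sigma> ` {1..Suc n} \<subseteq> {1..Suc n}"
    using p by (auto simp: ins_min_def intro!: perms_le[OF \<sigma>])
  ultimately have "bij_betw (ins_min p \<sigma>) {1..Suc n} {1..Suc n}"
    by (simp add: bij_betw_def endo_inj_surj)
  moreover have "ins_min p \<sigma> i = i" if "i \<notin> {1..Suc n}" for i
  proof (cases "i = 0")
    case False
    with that have "\<sigma> (i - 1) = i - 1"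
      using \<sigma> by (intro permutes_not_in[of \<sigma> "{1..n}"]) (auto simp: perms_def)
    then show ?thesis using that p False by (simp add: ins_min_def)
  qed (simp add: ins_min_def)
  ultimately show ?thesis
    unfolding perms_def by (blast intro: bij_imp_permutes)
qed

lemma ins_min_eq_1_iff:
  assumes "\<sigma> \<in> perms n" shows "ins_min p \<sigma> i = 1 \<longleftrightarrow> i = Suc p"
  using perms_pos[OF assms] by (auto simp: ins_min_def)

lemma inj_on_ins_min: "inj_on (\<lambda>(\<sigma>, p). ins_min p \<sigma>) (perms n \<times> {0..n})"
proof (clarsimp simp: inj_on_def)
  fix \<sigma> p \<sigma>' p'
  assume \<sigma>: "\<sigma> \<in> perms n" and \<sigma>': "\<sigma>' \<in> perms n" and eq: "ins_min p \<sigma> = ins_min p' \<sigma>'"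
  \<comment> \<open>The position of the letter 1 reveals \<open>p\<close>.\<close>
  have pp: "p = p'"
    using ins_min_eq_1_iff[OF \<sigma>, of p "Suc p"] ins_min_eq_1_iff[OF \<sigma>', of p' "Suc p"] eq by simp
  have "\<sigma> i = \<sigma>' i" for i
    using fun_cong[OF eq, of i] fun_cong[OF eq, of "Suc i"] perms_zero[OF \<sigma>] perms_zero[OF \<sigma>'] pp
    by (cases "i = 0"; cases "i \<le> p") (auto simp: ins_min_def)
  with pp show "\<sigma> = \<sigma>' \<and> p = p'" by auto
qed

lemma card_perms: "card (perms n) = fact n"
  unfolding perms_def by (simp add: card_permutations)

lemma finite_perms: "finite (perms n)"
  unfolding perms_def by (simp add: finite_permutations)

text \<open>Surjectivity comes from counting:
  \<open>(n + 1) * fact n = fact (n + 1)\<close>.\<close>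

lemma bij_betw_ins_min:
  "bij_betw (\<lambda>(\<sigma>, p). ins_min p \<sigma>) (perms n \<times> {0..n}) (perms (Suc n))"
  unfolding bij_betw_def
proof (intro conjI inj_on_ins_min card_subset_eq finite_perms)
  show "(\<lambda>(\<sigma>, p). ins_min p \<sigma>) ` (perms n \<times> {0..n}) \<subseteq> perms (Suc n)"
    by (auto intro: ins_min_perms)
  show "card ((\<lambda>(\<sigma>, p). ins_min p \<sigma>) ` (perms n \<times> {0..n})) = card (perms (Suc n))"
    by (simp add: card_image[OF inj_on_ins_min] card_cartesian_product card_perms)
qed

section \<open>Effect of an insertion on the statistics\<close>

definition stable :: "nat \<Rightarrow> nat \<Rightarrow> (nat \<Rightarrow> nat) \<Rightarrow> nat set" where
  "stable k n \<sigma> = {i \<in> {0..n}. \<sigma> i < k} \<union> DES k n \<sigma>"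

definition incr :: "nat set \<Rightarrow> nat \<Rightarrow> nat" where
  "incr S p = card {i \<in> S. p < i} + (if p \<in> S then 0 else p)"

lemma finite_DES [simp]: "finite (DES k n \<sigma>)"
  unfolding DES_def by simp

lemma DES_ge: "i \<in> DES k n \<sigma> \<Longrightarrow> k \<le> \<sigma> i"
  by (auto simp: DES_def)

text \<open>Old letters all rise by one, so comparisons between neighbours that stay adjacent
  survive. The letter before the new 1 starts a descent iff it was at least \<open>k\<close>; the 1
  itself starts none. For \<open>p = 0\<close> the convention \<open>\<sigma> 0 = 0\<close> rules
  out a descent at 0.\<close>

lemma DES_ins_min:
  assumes \<sigma>: "\<sigma> \<in> perms n" and "p \<le> n" "1 \<le> k"
  shows "DES k (Suc n) (ins_min p \<sigma>) =
    {i \<in> DES k n \<sigma>. i < p} \<union> (if k \<le> \<sigma> p then {p} else {}) \<union> Suc ` {i \<in> DES k n \<sigma>. p < i}"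
    (is "?L = ?R")
proof (rule set_eqI)
  fix i
  consider "i = 0" | "0 < i" "i < p" | "0 < i" "i = p" | "i = Suc p" | "Suc p < i"
    by (cases "i = 0"; cases "i < p"; cases "i = p"; cases "i = Suc p") auto
  then show "i \<in> ?L \<longleftrightarrow> i \<in> ?R"
  proof cases
    case 1
    then show ?thesis using perms_zero[OF \<sigma>] assms
      by (cases "p = 0") (auto simp: DES_def)
  next
    case 2
    then show ?thesis using assms by (auto simp: DES_def ins_min_def)
  next
    case 3
    then show ?thesis using assms by (auto simp: DES_def ins_min_def)
  next
    case 4
    then show ?thesis using assms by (auto simp: DES_def ins_min_def)
  next
    case 5
    then obtain j where "i = Suc j" "p < j" by (cases i) auto
    then show ?thesis using assms by (auto simp: DES_def ins_min_def)
  qed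
qed

lemma
  assumes \<sigma>: "\<sigma> \<in> perms n" and p: "p \<le> n" and k: "1 \<le> k"
  shows des_ins_min: "des k (Suc n) (ins_min p \<sigma>) =
      des k n \<sigma> + (if p \<in> stable k n \<sigma> then 0 else 1)"
    and maj_ins_min: "maj k (Suc n) (ins_min p \<sigma>) =
      maj k n \<sigma> + card {i \<in> DES k n \<sigma>. p < i} + (if p \<in> stable k n \<sigma> then 0 else p)"
proof -
  define A B C where "A = {i \<in> DES k n \<sigma>. i < p}" and "B = {i \<in> DES k n \<sigma>. p < i}"
    and "C = (if k \<le> \<sigma> p then {p} else {})"
  \<comment> \<open>Position \<open>p\<close> contributes \<open>C\<close> after and
    \<open>C'\<close> before the insertion. An old descent there survives, its letter being at least
    \<open>k\<close>, so the two differ exactly when \<open>p\<close> is not stable.\<close>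
  define C' where "C' = (if p \<in> DES k n \<sigma> then {p} else {})"
  have fin: "finite A" "finite B" "finite C" "finite C'"
    by (auto simp: A_def B_def C_def C'_def)
  have new: "DES k (Suc n) (ins_min p \<sigma>) = A \<union> C \<union> Suc ` B"
    using DES_ins_min[OF assms] by (simp add: A_def B_def C_def)
  have old: "DES k n \<sigma> = A \<union> C' \<union> B"
    by (auto simp: A_def B_def C'_def not_less le_less)
  have disj: "A \<inter> C = {}" "(A \<union> C) \<inter> Suc ` B = {}" "A \<inter> C' = {}" "(A \<union> C') \<inter> B = {}"
    by (auto simp: A_def B_def C_def C'_def)
  have stable: "p \<in> stable k n \<sigma> \<longleftrightarrow> \<sigma> p < k \<or> p \<in> DES k n \<sigma>"
    using p by (auto simp: stable_def)
  have C: "card C = card C' + (if p \<in> stable k n \<sigma> then 0 else 1)"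
    "\<Sum>C = \<Sum>C' + (if p \<in> stable k n \<sigma> then 0 else p)"
    unfolding stable using DES_ge[of p k n \<sigma>] by (auto simp: C_def C'_def)
  show "des k (Suc n) (ins_min p \<sigma>) = des k n \<sigma> + (if p \<in> stable k n \<sigma> then 0 else 1)"
    unfolding des_def new old using disj fin C(1)
    by (simp add: card_Un_disjoint card_image)
  have "\<Sum>(Suc ` B) = \<Sum>B + card B"
    by (simp add: sum.reindex sum.distrib flip: sum_Suc)
  then show "maj k (Suc n) (ins_min p \<sigma>) =
      maj k n \<sigma> + card {i \<in> DES k n \<sigma>. p < i} + (if p \<in> stable k n \<sigma> then 0 else p)"
    unfolding maj_def new B_def[symmetric] using disj fin C(2)
    by (subst old) (simp add: sum.union_disjoint)
qed

text \<open>The new 1 is the least letter, so it is never the larger entry of a close pair; as the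
  smaller one it pairs with every later letter whose old value was below \<open>k\<close>. All other
  pairs are only relocated.\<close>

lemma card_close_pairs_ins_min:
  assumes \<sigma>: "\<sigma> \<in> perms n" and p: "p \<le> n"
  shows "card {(i, j) \<in> {1..Suc n} \<times> {1..Suc n}. i < j \<and> ins_min p \<sigma> i < ins_min p \<sigma> j
            \<and> ins_min p \<sigma> j < ins_min p \<sigma> i + k} =
         card {(i, j) \<in> {1..n} \<times> {1..n}. i < j \<and> \<sigma> i < \<sigma> j \<and> \<sigma> j < \<sigma> i + k}
         + card {i \<in> {0..n}. \<sigma> i < k \<and> p < i}"
    (is "card ?T = card ?P + card ?Q")
proof -
  \<comment> \<open>\<open>f\<close> sends an old position to its new one, skipping
    \<open>Suc p\<close>.\<close>
  define f where "f = (\<lambda>i. if i \<le> p then i else Suc i)"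
  have f_less: "f i < f j \<longleftrightarrow> i < j" for i j by (auto simp: f_def)
  have f_ne: "f i \<noteq> Suc p" for i by (auto simp: f_def)
  have f_val: "ins_min p \<sigma> (f i) = Suc (\<sigma> i)" if "0 < i" for i
    using that by (auto simp: ins_min_def f_def)
  have f_range: "f i \<in> {1..Suc n} \<longleftrightarrow> i \<in> {1..n}" for i
    using p by (auto simp: f_def)
  have f_cases: "i = Suc p \<or> (\<exists>j. i = f j)" for i
  proof (cases i "Suc p" rule: linorder_cases)
    case greater
    then have "i = f (i - 1)" by (auto simp: f_def)
    then show ?thesis by blast
  qed (auto simp: f_def intro!: exI[of _ i])
  have ins_p: "ins_min p \<sigma> (Suc p) = 1" by (simp add: ins_min_def)
  have T: "?T = map_prod f f ` ?P \<union> (\<lambda>j. (Suc p, f j)) ` ?Q"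
  proof (intro equalityI subsetI)
    fix x assume x: "x \<in> ?T"
    then obtain i j where ij: "x = (i, j)" "i \<in> {1..Suc n}" "j \<in> {1..Suc n}" "i < j"
      "ins_min p \<sigma> i < ins_min p \<sigma> j" "ins_min p \<sigma> j < ins_min p \<sigma> i + k" by auto
    have "j \<noteq> Suc p" using ij ins_p ins_min_eq_1_iff[OF \<sigma>, of p i]
      by (auto simp: ins_min_def split: if_splits)
    then obtain j' where j': "j = f j'" using f_cases by blast
    then have j'n: "j' \<in> {1..n}" using ij f_range by blast
    show "x \<in> map_prod f f ` ?P \<union> (\<lambda>j. (Suc p, f j)) ` ?Q"
    proof (cases "i = Suc p")
      case True
      then have "p < j'" using ij j' by (auto simp: f_def split: if_splits)
      then have "j' \<in> ?Q" using ij j' j'n True by (auto simp: ins_p f_val)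
      then show ?thesis using True ij j' by auto
    next
      case False
      then obtain i' where i': "i = f i'" using f_cases by blast
      then have i'n: "i' \<in> {1..n}" using ij f_range by blast
      have "(i', j') \<in> ?P" using ij i' j' i'n j'n by (auto simp: f_val f_less)
      then show ?thesis using i' j' ij by (auto intro!: image_eqI[of _ _ "(i', j')"])
    qed
  next
    fix x assume "x \<in> map_prod f f ` ?P \<union> (\<lambda>j. (Suc p, f j)) ` ?Q"
    then show "x \<in> ?T"
    proof
      assume "x \<in> map_prod f f ` ?P"
      then obtain i j where "x = (f i, f j)" "(i, j) \<in> ?P" by auto
      then show ?thesis using f_range[of i] f_range[of j] by (auto simp: f_val f_less)
    next
      assume "x \<in> (\<lambda>j. (Suc p, f j)) ` ?Q"
      then obtain j where j: "x = (Suc p, f j)" "j \<in> ?Q" by auto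
      then have "Suc p < f j" by (auto simp: f_def)
      then show ?thesis using j p f_range[of j] perms_pos[OF \<sigma>, of j]
        by (auto simp: f_val ins_p)
    qed
  qed
  have inj: "inj f" by (auto simp: inj_def f_def split: if_splits)
  have finP: "finite ?P" by (rule finite_subset[of _ "{1..n} \<times> {1..n}"]) auto
  have "card ?T = card (map_prod f f ` ?P) + card ((\<lambda>j. (Suc p, f j)) ` ?Q)"
    unfolding T
  proof (rule card_Un_disjoint)
    show "map_prod f f ` ?P \<inter> (\<lambda>j. (Suc p, f j)) ` ?Q = {}"
      using f_ne by (auto dest: sym)
  qed (use finP in auto)
  also have "card (map_prod f f ` ?P) = card ?P"
    by (intro card_image inj_on_subset[OF prod.inj_map[OF inj inj]]) auto
  also have "card ((\<lambda>j. (Suc p, f j)) ` ?Q) = card ?Q"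
    using inj by (intro card_image) (auto simp: inj_on_def)
  finally show ?thesis .
qed

text \<open>Each descent beyond \<open>p\<close> moves one place right, and each letter below
  \<open>k\<close> beyond \<open>p\<close> forms a new close pair. These two disjoint sets make up
  the stable positions beyond \<open>p\<close>.\<close>

lemma maj_tilde_ins_min:
  assumes "\<sigma> \<in> perms n" "p \<le> n" "1 \<le> k"
  shows "maj_tilde k (Suc n) (ins_min p \<sigma>) = maj_tilde k n \<sigma> + incr (stable k n \<sigma>) p"
proof -
  have "{i \<in> stable k n \<sigma>. p < i} = {i \<in> DES k n \<sigma>. p < i} \<union> {i \<in> {0..n}. \<sigma> i < k \<and> p < i}"
    by (auto simp: stable_def)
  moreover have "{i \<in> DES k n \<sigma>. p < i} \<inter> {i \<in> {0..n}. \<sigma> i < k \<and> p < i} = {}"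
    by (auto dest: DES_ge)
  ultimately have "card {i \<in> stable k n \<sigma>. p < i} =
      card {i \<in> DES k n \<sigma>. p < i} + card {i \<in> {0..n}. \<sigma> i < k \<and> p < i}"
    by (simp add: card_Un_disjoint)
  then show ?thesis
    unfolding maj_tilde_def maj_ins_min[OF assms] card_close_pairs_ins_min[OF assms(1,2)] incr_def
    by simp
qed

section \<open>The increments\<close>

text \<open>The \<open>p\<close> numbers below \<open>p\<close> split by membership in
  \<open>S\<close>; the members join those beyond \<open>p\<close> to give all of
  \<open>S\<close>.\<close>

lemma incr_notin:
  assumes "finite S" "p \<notin> S"
  shows "incr S p = card S + card ({..<p} - S)"
proof -
  have "card S = card ({..<p} \<inter> S) + card {i \<in> S. p < i}"
    using assms
    by (subst card_Un_disjoint[symmetric]) (auto intro!: arg_cong[of _ _ card] simp: not_less le_less)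
  moreover have "p = card ({..<p} \<inter> S) + card ({..<p} - S)"
    using card_Int_Diff[of "{..<p}" S] by simp
  ultimately show ?thesis using assms(2) by (simp add: incr_def)
qed

lemma incr_less_iff:
  assumes "finite S" shows "incr S p < card S \<longleftrightarrow> p \<in> S"
proof (cases "p \<in> S")
  case True
  then have "{i \<in> S. p < i} \<subset> S" by auto
  then show ?thesis using assms True by (simp add: incr_def psubset_card_mono)
qed (simp add: incr_notin[OF assms])

text \<open>On \<open>S\<close> the counted set shrinks as the argument grows; off \<open>S\<close>
  the set counted in \<open>incr_notin\<close> grows.\<close>

lemma incr_strict:
  assumes S: "finite S" and "p < q" "p \<in> S \<longleftrightarrow> q \<in> S"
  shows "incr S p \<noteq> incr S q"
proof (cases "p \<in> S")
  case True
  then have "{i \<in> S. q < i} \<subset> {i \<in> S. p < i}" using assms by auto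
  then show ?thesis using S True assms(3) psubset_card_mono[of "{i \<in> S. p < i}" "{i \<in> S. q < i}"]
    by (simp add: incr_def)
next
  case False
  then have "{..<p} - S \<subset> {..<q} - S" using assms by auto
  then show ?thesis using False assms(3) psubset_card_mono[of "{..<q} - S" "{..<p} - S"]
    by (simp add: incr_notin[OF S])
qed

text \<open>Values at members of \<open>S\<close> lie below \<open>card S\<close> and all others do
  not, so a collision would need two arguments of the same kind.\<close>

lemma inj_incr: "finite S \<Longrightarrow> inj (incr S)"
  by (rule injI) (metis incr_less_iff incr_strict linorder_neqE_nat)

lemma incr_le:
  assumes "S \<subseteq> {0..n}" "p \<le> n" shows "incr S p \<le> n"
proof -
  have "card {i \<in> S. p < i} \<le> card {p<..n}"
    using assms by (intro card_mono) auto
  then show ?thesis using assms by (auto simp: incr_def)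
qed

lemma bij_betw_incr:
  assumes "S \<subseteq> {0..n}" shows "bij_betw (incr S) {0..n} {0..<Suc n}"
proof -
  have "inj_on (incr S) {0..n}"
    by (rule inj_on_subset[OF inj_incr[OF finite_subset[OF assms]]]) simp_all
  moreover have "incr S ` {0..n} \<subseteq> {0..n}" by (auto intro: incr_le[OF assms])
  ultimately show ?thesis
    by (simp add: bij_betw_def endo_inj_surj atLeastLessThanSuc_atLeastAtMost)
qed

lemma incr_0: "finite S \<Longrightarrow> 0 \<in> S \<Longrightarrow> incr S 0 = card S - 1"
proof -
  assume "finite S" "0 \<in> S"
  moreover have "{i \<in> S. 0 < i} = S - {0}" by auto
  ultimately show ?thesis by (simp add: incr_def)
qed

section \<open>Size of the stable set and the threshold of \<open>st\<close>\<close>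

lemma stable_subset: "stable k n \<sigma> \<subseteq> {0..n}"
  by (auto simp: stable_def DES_def)

lemma finite_stable: "finite (stable k n \<sigma>)"
  by (rule finite_subset[OF stable_subset]) simp

lemma zero_in_stable: "\<sigma> \<in> perms n \<Longrightarrow> 1 \<le> k \<Longrightarrow> 0 \<in> stable k n \<sigma>"
  using perms_zero[of \<sigma> n] by (simp add: stable_def)

text \<open>Since \<open>\<sigma> 0 = 0\<close>, the values on \<open>{0..n}\<close> are exactly 0
  to n, so \<open>k\<close> of them lie below \<open>k\<close>. Descents start at letters of at
  least \<open>k\<close> and are counted separately.\<close>

lemma card_stable:
  assumes \<sigma>: "\<sigma> \<in> perms n" and k: "k \<le> Suc n"
  shows "card (stable k n \<sigma>) = k + des k n \<sigma>"
proof -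
  have img: "\<sigma> ` {0..n} = {0..n}"
    using perms_le[OF \<sigma>] perms_eq_iff[OF \<sigma>] by (intro endo_inj_surj) (auto simp: inj_on_def)
  have "\<sigma> ` {i \<in> {0..n}. \<sigma> i < k} = {x \<in> \<sigma> ` {0..n}. x < k}"
    by auto
  also have "\<dots> = {0..<k}"
    unfolding img using k by auto
  finally have "card {i \<in> {0..n}. \<sigma> i < k} = k"
    using card_image[of \<sigma> "{i \<in> {0..n}. \<sigma> i < k}"] perms_eq_iff[OF \<sigma>] by (simp add: inj_on_def)
  moreover have "{i \<in> {0..n}. \<sigma> i < k} \<inter> DES k n \<sigma> = {}"
    by (auto dest: DES_ge)
  ultimately show ?thesis
    unfolding stable_def des_def by (simp add: card_Un_disjoint)
qed

text \<open>For \<open>k \<le> Suc n\<close> the bound is one less than the size of the stable set.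
  For larger \<open>k\<close> every slot is stable and increments are at most \<open>n\<close>, so
  both sides hold.\<close>

lemma incr_stable_le_iff:
  assumes \<sigma>: "\<sigma> \<in> perms n" and p: "p \<le> n" and k: "1 \<le> k"
  shows "incr (stable k n \<sigma>) p \<le> des k n \<sigma> + k - 1 \<longleftrightarrow> p \<in> stable k n \<sigma>"
proof (cases "k \<le> Suc n")
  case True
  then show ?thesis
    using incr_less_iff[OF finite_stable, of k n \<sigma> p] card_stable[OF \<sigma> True] k by auto
next
  case False
  then have "p \<in> stable k n \<sigma>"
    using perms_le[OF \<sigma> p] p by (simp add: stable_def)
  moreover have "incr (stable k n \<sigma>) p \<le> n"
    by (rule incr_le[OF stable_subset p])
  ultimately show ?thesis using False by simp
qed

lemma des_ins_min_incr:
  assumes "\<sigma> \<in> perms n" "p \<le> n" "1 \<le> k"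
  shows "des k (Suc n) (ins_min p \<sigma>) =
    (if incr (stable k n \<sigma>) p \<le> des k n \<sigma> + k - 1 then des k n \<sigma> else des k n \<sigma> + 1)"
  unfolding des_ins_min[OF assms] incr_stable_le_iff[OF assms] by (cases "p \<in> stable k n \<sigma>") simp_all

text \<open>Let d be \<open>des (k + 1) n \<sigma>\<close>. Stability means an increment of at most
  d + k, while the threshold here is d + k - 1 if \<open>des_tilde\<close> equals d, and d + k
  otherwise. A conflict needs the increment d + k, which for \<open>k \<le> n\<close> belongs to
  \<open>p = 0\<close> alone.\<close>

lemma des_tilde_ins_min_incr:
  assumes \<sigma>: "\<sigma> \<in> perms n" and p: "p \<le> n" and k: "1 \<le> k"
  shows "des_tilde (k + 1) (Suc n) (ins_min p \<sigma>) =
    (if incr (stable (k + 1) n \<sigma>) p \<le> des_tilde (k + 1) n \<sigma> + k - 1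
     then des_tilde (k + 1) n \<sigma> else des_tilde (k + 1) n \<sigma> + 1)"
proof -
  let ?S = "stable (k + 1) n \<sigma>" and ?d = "des (k + 1) n \<sigma>"
  have k1: "1 \<le> k + 1" by simp
  note des = des_ins_min[OF \<sigma> p k1]
  note le_iff = incr_stable_le_iff[OF \<sigma> p k1]
  have le_n: "incr ?S p \<le> n" by (rule incr_le[OF stable_subset p])
  have pos: "0 < \<sigma> 1" using perms_pos[OF \<sigma>] by simp
  have inc0: "incr ?S 0 = ?d + k" if "k + 1 \<le> Suc n"
    using incr_0[OF finite_stable zero_in_stable[OF \<sigma> k1]] card_stable[OF \<sigma> that] by simp
  show ?thesis
  proof (cases "p = 0")
    case True
    \<comment> \<open>With first letter 1, the extra descent is present iff
      \<open>k \<le> n\<close>.\<close>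
    then have "ins_min p \<sigma> 1 = 1" by (simp add: ins_min_def)
    moreover have "p \<in> ?S" using zero_in_stable[OF \<sigma> k1] True by simp
    ultimately show ?thesis
      using des le_n inc0 True pos k by (auto simp: des_tilde_def)
  next
    case False
    \<comment> \<open>First letter and length both grow by one, so the extra descent is present
      after the insertion iff it was before.\<close>
    then have "ins_min p \<sigma> 1 = Suc (\<sigma> 1)" by (simp add: ins_min_def)
    moreover have "incr ?S p \<noteq> ?d + k" if "k + 1 \<le> Suc n"
      using False inc0[OF that] inj_incr[OF finite_stable] by (metis injD)
    \<comment> \<open>For \<open>k > n\<close> increments are at most \<open>n\<close>, hence within
      both thresholds.\<close>
    ultimately show ?thesis
      using des le_n le_iff k by (cases "k \<le> n") (auto simp: des_tilde_def)
  qed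
qed

section \<open>Building the code\<close>

lemma st_cong: "\<forall>i\<le>m. c i = c' i \<Longrightarrow> st k m c = st k m c'"
proof (induction m)
  case (Suc m)
  have "st k m c = st k m c'" by (rule Suc.IH) (use Suc.prems in force)
  moreover have "c (Suc m) = c' (Suc m)" using Suc.prems by blast
  ultimately show ?case by (cases m) simp_all
qed simp

text \<open>The conventional value at length 0 fits the recursion because a code starts with 0, so
  the induction on length needs no separate case for length 1.\<close>

lemma st_Suc:
  "c (Suc 0) = 0 \<Longrightarrow>
   st k (Suc m) c = (if c (Suc m) \<le> st k m c + k - 1 then st k m c else st k m c + 1)"
  by (cases m) auto

lemma codes_Suc:
  "codes (Suc n) = (\<lambda>(y, c). c(Suc n := y)) ` ({0..<Suc n} \<times> codes n)"
  "inj_on (\<lambda>(y, c). c(Suc n := y)) ({0..<Suc n} \<times> codes n)"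
proof -
  have "{1..Suc n} = insert (Suc n) {1..n}" by auto
  then show "codes (Suc n) = (\<lambda>(y, c). c(Suc n := y)) ` ({0..<Suc n} \<times> codes n)"
    unfolding codes_def by (simp only: PiE_insert_eq)
  show "inj_on (\<lambda>(y, c). c(Suc n := y)) ({0..<Suc n} \<times> codes n)"
    unfolding codes_def using inj_combinator[of "Suc n" "{1..n}" "\<lambda>i. {0..<i}"] by simp
qed

lemma codes_1: "c \<in> codes n \<Longrightarrow> 1 \<le> n \<Longrightarrow> c (Suc 0) = 0"
  by (auto simp: codes_def PiE_iff dest: bspec[of _ _ "Suc 0"])

lemma st_upd:
  assumes "c(Suc n := y) \<in> codes (Suc n)"
  shows "st k (Suc n) (c(Suc n := y)) = (if y \<le> st k n c + k - 1 then st k n c else st k n c + 1)"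
proof -
  have "st k n (c(Suc n := y)) = st k n c" by (rule st_cong) auto
  then show ?thesis using st_Suc[where c = "c(Suc n := y)", OF codes_1[OF assms]] by simp
qed

lemma code_sum_upd: "code_sum (Suc n) (c(Suc n := y)) = code_sum n c + y"
  by (simp add: code_sum_def)

text \<open>The stable set varies with \<sigma>, but for each \<sigma> the increments run once
  through the same range \<open>{0..<Suc n}\<close>; hence prefix and last entry can be chosen
  independently.\<close>

lemma bij_betw_append_incr:
  assumes \<Phi>: "bij_betw \<Phi> (perms n) (codes n)"
  shows "bij_betw (\<lambda>(\<sigma>, p). (\<Phi> \<sigma>)(Suc n := incr (stable k n \<sigma>) p))
           (perms n \<times> {0..n}) (codes (Suc n))"
proof -
  note v = bij_betw_incr[OF stable_subset]
  have "bij_betw (\<lambda>(\<sigma>, p). (incr (stable k n \<sigma>) p, \<Phi> \<sigma>)) (perms n \<times> {0..n})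
      ({0..<Suc n} \<times> codes n)"
    unfolding bij_betw_def
  proof (intro conjI inj_onI equalityI subsetI)
    fix x y assume xy: "x \<in> perms n \<times> {0..n}" "y \<in> perms n \<times> {0..n}"
      "(case x of (\<sigma>, p) \<Rightarrow> (incr (stable k n \<sigma>) p, \<Phi> \<sigma>)) =
       (case y of (\<sigma>, p) \<Rightarrow> (incr (stable k n \<sigma>) p, \<Phi> \<sigma>))"
    obtain \<sigma> p \<tau> q where *: "x = (\<sigma>, p)" "y = (\<tau>, q)" by (cases x; cases y)
    have "\<sigma> = \<tau>"
      by (rule inj_onD[OF bij_betw_imp_inj_on[OF \<Phi>]]) (use xy * in simp_all)
    have "incr (stable k n \<sigma>) p = incr (stable k n \<sigma>) q"
      using xy(3) unfolding * \<open>\<sigma> = \<tau>\<close> by simp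
    then have "p = q"
      by (rule injD[OF inj_incr[OF finite_stable]])
    then show "x = y" unfolding * \<open>\<sigma> = \<tau>\<close> by simp
  next
    fix x assume "x \<in> (\<lambda>(\<sigma>, p). (incr (stable k n \<sigma>) p, \<Phi> \<sigma>)) ` (perms n \<times> {0..n})"
    then show "x \<in> {0..<Suc n} \<times> codes n"
      using bij_betwE[OF \<Phi>] bij_betwE[OF v] by fast
  next
    fix x assume "x \<in> {0..<Suc n} \<times> codes n"
    then obtain y c where x: "x = (y, c)" "y \<in> {0..<Suc n}" "c \<in> codes n" by blast
    then obtain \<sigma> where \<sigma>: "\<sigma> \<in> perms n" "c = \<Phi> \<sigma>"
      using bij_betw_imp_surj_on[OF \<Phi>] by blast
    obtain p where "p \<in> {0..n}" "y = incr (stable k n \<sigma>) p"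
      using bij_betw_imp_surj_on[OF v, of k n \<sigma>] x(2) by blast
    with x \<sigma> show "x \<in> (\<lambda>(\<sigma>, p). (incr (stable k n \<sigma>) p, \<Phi> \<sigma>)) ` (perms n \<times> {0..n})"
      by force
  qed
  moreover have "bij_betw (\<lambda>(y, c). c(Suc n := y)) ({0..<Suc n} \<times> codes n) (codes (Suc n))"
    using codes_Suc by (simp add: bij_betw_def)
  ultimately have "bij_betw ((\<lambda>(y, c). c(Suc n := y)) \<circ>
      (\<lambda>(\<sigma>, p). (incr (stable k n \<sigma>) p, \<Phi> \<sigma>))) (perms n \<times> {0..n}) (codes (Suc n))"
    by (rule bij_betw_trans)
  then show ?thesis by (simp add: comp_def case_prod_unfold)
qed

text \<open>
  The induction can start at the empty permutation: all the statistics vanish on it.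
\<close>

lemma exists_code_bij:
  assumes k: "1 \<le> k"
  shows "\<exists>\<Phi>. bij_betw \<Phi> (perms n) (codes n) \<and> (\<forall>\<sigma>\<in>perms n.
    maj_tilde k n \<sigma> = code_sum n (\<Phi> \<sigma>) \<and> des k n \<sigma> = st k n (\<Phi> \<sigma>) \<and>
    (2 \<le> k \<longrightarrow> des_tilde k n \<sigma> = st (k - 1) n (\<Phi> \<sigma>)))"
proof (induction n)
  case 0
  have p0: "perms 0 = {id}" by (auto simp: perms_def)
  have c0: "codes 0 = {\<lambda>_. undefined}" by (simp add: codes_def)
  \<comment> \<open>At length 0 the test in \<open>des_tilde\<close> reads \<open>1 + k > 1\<close>,
    which holds, so no extra descent is counted.\<close>
  show ?case
    unfolding p0 c0
    by (rule exI[of _ "\<lambda>_ _. undefined"])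
       (use k in \<open>auto simp: bij_betw_def maj_tilde_def maj_def des_def DES_def code_sum_def
          des_tilde_def\<close>)
next
  case (Suc n)
  then obtain \<Phi> where \<Phi>: "bij_betw \<Phi> (perms n) (codes n)"
    and stats: "\<And>\<sigma>. \<sigma> \<in> perms n \<Longrightarrow> maj_tilde k n \<sigma> = code_sum n (\<Phi> \<sigma>) \<and>
      des k n \<sigma> = st k n (\<Phi> \<sigma>) \<and> (2 \<le> k \<longrightarrow> des_tilde k n \<sigma> = st (k - 1) n (\<Phi> \<sigma>))"
    by blast
  let ?A = "perms n \<times> {0..n}"
  let ?I = "\<lambda>(\<sigma>, p). ins_min p \<sigma>"
  let ?G = "\<lambda>(\<sigma>, p). (\<Phi> \<sigma>)(Suc n := incr (stable k n \<sigma>) p)"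
  \<comment> \<open>Remove the smallest letter, encode the rest by \<open>\<Phi>\<close>, and append
    the increment of its slot.\<close>
  let ?\<Psi> = "?G \<circ> inv_into ?A ?I"
  note I = bij_betw_ins_min[of n] and G = bij_betw_append_incr[OF \<Phi>, of k]
  have "bij_betw ?\<Psi> (perms (Suc n)) (codes (Suc n))"
    by (rule bij_betw_trans[OF bij_betw_inv_into[OF I] G])
  moreover have "maj_tilde k (Suc n) \<tau> = code_sum (Suc n) (?\<Psi> \<tau>) \<and>
      des k (Suc n) \<tau> = st k (Suc n) (?\<Psi> \<tau>) \<and>
      (2 \<le> k \<longrightarrow> des_tilde k (Suc n) \<tau> = st (k - 1) (Suc n) (?\<Psi> \<tau>))"
    if \<tau>_perm: "\<tau> \<in> perms (Suc n)" for \<tau>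
  proof -
    obtain \<sigma> p where \<sigma>: "\<sigma> \<in> perms n" and p: "p \<le> n" and \<tau>: "\<tau> = ins_min p \<sigma>"
      using \<tau>_perm[folded bij_betw_imp_surj_on[OF I]] by auto
    have "inv_into ?A ?I \<tau> = (\<sigma>, p)"
      using inv_into_f_f[OF bij_betw_imp_inj_on[OF I], of "(\<sigma>, p)"] \<sigma> p \<tau> by simp
    then have \<Psi>: "?\<Psi> \<tau> = (\<Phi> \<sigma>)(Suc n := incr (stable k n \<sigma>) p)" by simp
    have "(\<Phi> \<sigma>)(Suc n := incr (stable k n \<sigma>) p) \<in> codes (Suc n)"
      using bij_betwE[OF G] \<sigma> p by fastforce
    note st = st_upd[OF this]
    have "des_tilde k (Suc n) \<tau> = st (k - 1) (Suc n) (?\<Psi> \<tau>)" if "2 \<le> k"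
    proof -
      have k1: "k - 1 + 1 = k" "1 \<le> k - 1" using that by simp_all
      show ?thesis
        unfolding \<Psi> st unfolding \<tau>
        using des_tilde_ins_min_incr[OF \<sigma> p k1(2), unfolded k1(1)] stats[OF \<sigma>] that by simp
    qed
    moreover have "maj_tilde k (Suc n) \<tau> = code_sum (Suc n) (?\<Psi> \<tau>)"
      unfolding \<Psi> code_sum_upd unfolding \<tau> using maj_tilde_ins_min[OF \<sigma> p k] stats[OF \<sigma>] by simp
    moreover have "des k (Suc n) \<tau> = st k (Suc n) (?\<Psi> \<tau>)"
      unfolding \<Psi> st unfolding \<tau> using des_ins_min_incr[OF \<sigma> p k] stats[OF \<sigma>] by simp
    ultimately show ?thesis by blast
  qed
  ultimately show ?case by (intro exI[of _ ?\<Psi>]) blast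
qed

theorem theorem3p1:
  fixes n :: nat
  assumes "n \<ge> 1"
  shows "\<exists>\<Phi> :: nat \<Rightarrow> (nat \<Rightarrow> nat) \<Rightarrow> (nat \<Rightarrow> nat).
           \<forall>k\<ge>1. bij_betw (\<Phi> k) (perms n) (codes n) \<and>
             (\<forall>\<sigma>\<in>perms n.
                maj_tilde k n \<sigma> = code_sum n (\<Phi> k \<sigma>) \<and>
                des k n \<sigma> = st k n (\<Phi> k \<sigma>) \<and>
                des_tilde (k + 1) n \<sigma> = st k n (\<Phi> (k + 1) \<sigma>))"
proof -
  \<comment> \<open>Different \<open>k\<close> impose no joint condition: the third clause at
    \<open>k\<close> concerns only the map for \<open>k + 1\<close>, so one map is chosen for each
    index.\<close>
  obtain \<Phi> where \<Phi>: "\<And>k. 1 \<le> k \<Longrightarrow> bij_betw (\<Phi> k) (perms n) (codes n) \<and> (\<forall>\<sigma>\<in>perms n.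
      maj_tilde k n \<sigma> = code_sum n (\<Phi> k \<sigma>) \<and> des k n \<sigma> = st k n (\<Phi> k \<sigma>) \<and>
      (2 \<le> k \<longrightarrow> des_tilde k n \<sigma> = st (k - 1) n (\<Phi> k \<sigma>)))"
    using exists_code_bij[of _ n] by metis
  have "des_tilde (k + 1) n \<sigma> = st k n (\<Phi> (k + 1) \<sigma>)" if "1 \<le> k" "\<sigma> \<in> perms n" for k \<sigma>
    using \<Phi>[of "k + 1"] that by simp
  with \<Phi> show ?thesis by (intro exI[of _ \<Phi>]) blast
qed

end
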